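(* Let $A$ and $B\ge 0$ be two random variables on a common probability space such that $$E\exp\Big\{\lambda A-\frac{\lambda^2}{2}B^2\Big\}\le 1\qquad\text{for all }\lambda\in\mathbf{R}.$$ Then for all $y>0$, $$E\,\frac{y}{\sqrt{B^2+y^2}}\exp\Big\{\frac{A^2}{2(B^2+y^2)}\Big\}\le 1.$$ Consequently, if $EB>0$, then $$E\exp\Big(\frac{A^2}{4(B^2+(EB)^2)}\Big)\le\sqrt{2}$$ and $$E\exp\Big(\frac{xA}{\sqrt{B^2+(EB)^2}}\Big)\le\sqrt{2}\exp(x^2)\qquad\text{for all }x>0.$$ Moreover (still when $EB>0$), for all $p>0$, $$E\Big(\frac{|A|}{\sqrt{B^2+(EB)^2}}\Big)^p\le 2^{p-1/2}\,p\,\Gamma(p/2).$$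
   Context: $\Gamma$ is the Gamma function. If $EB=\infty$, the quotients with $(EB)^2$ in the denominator are interpreted as $0$. *)

theory Defs
  imports "HOL-Probability.Probability"
begin

text \<open>
  A quotient \<open>q m\<close> with \<open>m\<^sup>2\<close> in its denominator, where \<open>m\<close> is the possibly infinite mean of a
  nonnegative random variable. The quotient is read as \<open>0\<close> when the mean is infinite.
\<close>
definition quot_at_mean :: "ennreal \<Rightarrow> (real \<Rightarrow> real) \<Rightarrow> real" where
  "quot_at_mean m q = (if m = \<infinity> then 0 else q (enn2real m))"

end

theory Submission
  imports Defs
begin

text \<open>
  Write \<open>D \<omega> = (B \<omega>)\<^sup>2 + y\<^sup>2\<close>. The hypothesis bounds an expectation by \<open>1\<close> for every fixed \<open>l\<close>,
  so the bound survives averaging over any probability distribution of \<open>l\<close>. For the centred normal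
  distribution of variance \<open>1 / y\<^sup>2\<close>, exchanging the two integrals gives the first bound:
  completing the square in \<open>l\<close> turns the inner integral into \<open>y / sqrt D * exp (A\<^sup>2 / (2 * D))\<close>
  (lemmas \<open>normal_density_mult_exp\<close> and \<open>gaussian_mixture_bound\<close>).

  Everything else comes from taking \<open>y = E B\<close> and comparing integrands pointwise. The factor
  \<open>y / sqrt D\<close> is removed by the arithmetic-geometric mean inequality, at the price of its
  reciprocal \<open>sqrt D / y\<close>; that reciprocal is at most \<open>1 + B / y\<close>, whose mean is \<open>2\<close>
  (lemma \<open>exp_quarter_square_bound\<close>). With \<open>w = A / sqrt D\<close> this says \<open>E exp (w\<^sup>2 / 4) \<le> sqrt 2\<close>.
  The exponential bound follows from \<open>x * w \<le> x\<^sup>2 + w\<^sup>2 / 4\<close>, and the moment bound from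
  \<open>u powr s / exp u \<le> Gamma (s + 1)\<close> at \<open>u = w\<^sup>2 / 4\<close> and \<open>s = p / 2\<close>.
  If \<open>E B\<close> is infinite, the quotients vanish and the bounds are trivial.
\<close>

section \<open>Averaging over a Gaussian parameter\<close>

text \<open>
  Completing the square: tilting a centred Gaussian density by the exponential of a quadratic
  gives a constant multiple of another Gaussian density.
\<close>
lemma normal_density_mult_exp:
  fixes a b y l :: real
  assumes "y > 0"
  defines "D \<equiv> b\<^sup>2 + y\<^sup>2"
  shows "normal_density 0 (1 / y) l * exp (l * a - l\<^sup>2 / 2 * b\<^sup>2) =
         y / sqrt D * exp (a\<^sup>2 / (2 * D)) * normal_density (a / D) (1 / sqrt D) l"
proof -
  have D: "D > 0"
    using assms by (simp add: sum_power2_gt_zero_iff)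
  have "- ((l - 0)\<^sup>2 / (2 * (1 / y)\<^sup>2)) + (l * a - l\<^sup>2 / 2 * b\<^sup>2) = l * a - l\<^sup>2 / 2 * D"
    by (simp add: D_def power_divide algebra_simps)
  also have "\<dots> = a\<^sup>2 / (2 * D) + - ((l - a / D)\<^sup>2 / (2 * (1 / sqrt D)\<^sup>2))"
    using D by (simp add: power_divide power2_diff field_simps) (simp add: power2_eq_square)
  finally have exponents:
    "exp (- ((l - 0)\<^sup>2 / (2 * (1 / y)\<^sup>2))) * exp (l * a - l\<^sup>2 / 2 * b\<^sup>2) =
     exp (a\<^sup>2 / (2 * D)) * exp (- ((l - a / D)\<^sup>2 / (2 * (1 / sqrt D)\<^sup>2)))"
    by (simp only: exp_add [symmetric])
  have factors: "1 / sqrt (2 * pi * (1 / y)\<^sup>2) = y / sqrt D * (1 / sqrt (2 * pi * (1 / sqrt D)\<^sup>2))"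
    using D assms(1) by (simp add: power_divide real_sqrt_divide)
  show ?thesis
    unfolding normal_density_def minus_divide_left [symmetric] factors
    using exponents by (simp add: mult_ac)
qed

lemma nn_integral_normal_density:
  assumes "\<sigma> > 0"
  shows "(\<integral>\<^sup>+ l. ennreal (normal_density \<mu> \<sigma> l) \<partial>lborel) = 1"
  using assms by (subst nn_integral_eq_integral) auto

lemma gaussian_mixture_bound:
  fixes A B :: "'a \<Rightarrow> real" and y :: real
  assumes sigma_finite: "sigma_finite_measure M"
    and [measurable]: "A \<in> borel_measurable M" "B \<in> borel_measurable M"
    and canonical: "\<And>l::real. (\<integral>\<^sup>+ \<omega>. ennreal (exp (l * A \<omega> - l\<^sup>2 / 2 * (B \<omega>)\<^sup>2)) \<partial>M) \<le> 1"
    and y: "y > 0"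
  shows "(\<integral>\<^sup>+ \<omega>. ennreal (y / sqrt ((B \<omega>)\<^sup>2 + y\<^sup>2) *
            exp ((A \<omega>)\<^sup>2 / (2 * ((B \<omega>)\<^sup>2 + y\<^sup>2)))) \<partial>M) \<le> 1"
proof -
  have product: "pair_sigma_finite M lborel"
    by (intro pair_sigma_finite.intro sigma_finite lborel.sigma_finite_measure_axioms)
  define c where "c \<omega> = y / sqrt ((B \<omega>)\<^sup>2 + y\<^sup>2) * exp ((A \<omega>)\<^sup>2 / (2 * ((B \<omega>)\<^sup>2 + y\<^sup>2)))" for \<omega>
  let ?n = "\<lambda>l. ennreal (normal_density 0 (1 / y) l)"
  let ?e = "\<lambda>\<omega> l. ennreal (exp (l * A \<omega> - l\<^sup>2 / 2 * (B \<omega>)\<^sup>2))"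
  have c: "ennreal (c \<omega>) = (\<integral>\<^sup>+ l. ?n l * ?e \<omega> l \<partial>lborel)" for \<omega>
  proof -
    have D: "(B \<omega>)\<^sup>2 + y\<^sup>2 > 0"
      using y by (simp add: sum_power2_gt_zero_iff)
    have "c \<omega> \<ge> 0"
      using y D by (simp add: c_def)
    then have "(\<integral>\<^sup>+ l. ?n l * ?e \<omega> l \<partial>lborel) =
        (\<integral>\<^sup>+ l. ennreal (c \<omega>) *
          ennreal (normal_density (A \<omega> / ((B \<omega>)\<^sup>2 + y\<^sup>2)) (1 / sqrt ((B \<omega>)\<^sup>2 + y\<^sup>2)) l) \<partial>lborel)"
      using normal_density_mult_exp [OF y] by (simp only: c_def normal_density_nonneg ennreal_mult' [symmetric])
    also have "\<dots> = ennreal (c \<omega>)"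
      using D by (simp add: nn_integral_cmult nn_integral_normal_density)
    finally show ?thesis ..
  qed
  have "(\<integral>\<^sup>+ \<omega>. ennreal (c \<omega>) \<partial>M) = (\<integral>\<^sup>+ \<omega>. (\<integral>\<^sup>+ l. ?n l * ?e \<omega> l \<partial>lborel) \<partial>M)"
    by (simp add: c)
  also have "\<dots> = (\<integral>\<^sup>+ l. (\<integral>\<^sup>+ \<omega>. ?n l * ?e \<omega> l \<partial>M) \<partial>lborel)"
    by (rule pair_sigma_finite.Fubini' [OF product, symmetric]) measurable
  also have "\<dots> = (\<integral>\<^sup>+ l. ?n l * (\<integral>\<^sup>+ \<omega>. ?e \<omega> l \<partial>M) \<partial>lborel)"
    by (simp add: nn_integral_cmult)
  also have "\<dots> \<le> (\<integral>\<^sup>+ l. ?n l * 1 \<partial>lborel)"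
    by (intro nn_integral_mono mult_left_mono canonical) simp
  also have "\<dots> = 1"
    using y by (simp add: nn_integral_normal_density)
  finally show ?thesis
    by (simp add: c_def)
qed

section \<open>Removing the random factor\<close>

text \<open>
  The arithmetic-geometric mean inequality for \<open>r * exp z\<close> and \<open>1 / r\<close>, whose geometric mean is
  \<open>exp (z / 2)\<close>, with weights \<open>sqrt 2\<close> and \<open>1 / sqrt 2\<close>. The weights are those for which
  both halves contribute \<open>sqrt 2 / 2\<close> when \<open>E (r * exp z) \<le> 1\<close> and \<open>E (1 / r) \<le> 2\<close>.
\<close>
lemma exp_half_le_weighted:
  fixes r z :: real
  assumes "r > 0"
  shows "exp (z / 2) \<le> (sqrt 2 / 2) * (r * exp z) + (sqrt 2 / 4) * (1 / r)"
proof -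
  define q where "q = sqrt 2 * r * exp (z / 2)"
  have "exp z = exp (z / 2) * exp (z / 2)"
    by (simp add: exp_add [symmetric])
  then have "(sqrt 2 / 2) * (r * exp z) + (sqrt 2 / 4) * (1 / r) - exp (z / 2)
      = sqrt 2 / (4 * r) * (q - 1)\<^sup>2"
    using assms real_sqrt_mult_self [of 2]
    by (simp add: q_def power2_eq_square field_simps) (simp flip: mult.assoc)
  also have "\<dots> \<ge> 0"
    using assms by simp
  finally show ?thesis by simp
qed

lemma sqrt_sum_squares_div_le:
  fixes b m :: real
  assumes "b \<ge> 0" "m > 0"
  shows "sqrt (b\<^sup>2 + m\<^sup>2) / m \<le> 1 + b / m"
  using sqrt_sum_squares_le_sum [of b m] assms by (simp add: field_simps)

lemma exp_quarter_square_bound: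
  fixes A B :: "'a \<Rightarrow> real" and m :: real
  assumes prob: "prob_space M"
    and [measurable]: "A \<in> borel_measurable M" "B \<in> borel_measurable M"
    and B_nonneg: "AE \<omega> in M. 0 \<le> B \<omega>"
    and canonical: "\<And>l::real. (\<integral>\<^sup>+ \<omega>. ennreal (exp (l * A \<omega> - l\<^sup>2 / 2 * (B \<omega>)\<^sup>2)) \<partial>M) \<le> 1"
    and m: "m > 0" and mean: "(\<integral>\<^sup>+ \<omega>. ennreal (B \<omega>) \<partial>M) = ennreal m"
  shows "(\<integral>\<^sup>+ \<omega>. ennreal (exp ((A \<omega>)\<^sup>2 / (4 * ((B \<omega>)\<^sup>2 + m\<^sup>2)))) \<partial>M) \<le> ennreal (sqrt 2)"
proof -
  let ?D = "\<lambda>\<omega>. (B \<omega>)\<^sup>2 + m\<^sup>2"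
  let ?c = "sqrt 2 / 2" and ?d = "sqrt 2 / 4"
  define f where "f \<omega> = m / sqrt (?D \<omega>) * exp ((A \<omega>)\<^sup>2 / (2 * ?D \<omega>))" for \<omega>
  have [measurable]: "f \<in> borel_measurable M"
    unfolding f_def by measurable
  have "AE \<omega> in M. ennreal (exp ((A \<omega>)\<^sup>2 / (4 * ?D \<omega>)))
      \<le> ennreal ?c * ennreal (f \<omega>) + ennreal ?d * (1 + ennreal (1 / m) * ennreal (B \<omega>))"
    using B_nonneg
  proof eventually_elim
    case (elim \<omega>)
    have D: "?D \<omega> > 0"
      using m by (simp add: sum_power2_gt_zero_iff)
    have f: "f \<omega> \<ge> 0"
      using m D by (simp add: f_def)
    have B: "1 / m * B \<omega> \<ge> 0"
      using m elim by simp
    have "exp ((A \<omega>)\<^sup>2 / (2 * ?D \<omega>) / 2) \<le> ?c * f \<omega> + ?d * (1 / (m / sqrt (?D \<omega>)))"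
      unfolding f_def using m D by (intro exp_half_le_weighted) simp
    also have "(A \<omega>)\<^sup>2 / (2 * ?D \<omega>) / 2 = (A \<omega>)\<^sup>2 / (4 * ?D \<omega>)"
      by simp
    also have "1 / (m / sqrt (?D \<omega>)) \<le> 1 + 1 / m * B \<omega>"
      using sqrt_sum_squares_div_le [OF elim m] by simp
    finally have "exp ((A \<omega>)\<^sup>2 / (4 * ?D \<omega>)) \<le> ?c * f \<omega> + ?d * (1 + 1 / m * B \<omega>)"
      by simp
    then have "ennreal (exp ((A \<omega>)\<^sup>2 / (4 * ?D \<omega>)))
        \<le> ennreal (?c * f \<omega> + ?d * (1 + 1 / m * B \<omega>))"
      by (rule ennreal_leI)
    also have "\<dots> = ennreal ?c * ennreal (f \<omega>) + ennreal ?d * (1 + ennreal (1 / m) * ennreal (B \<omega>))"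
      using f B m elim by (simp only: ennreal_plus ennreal_mult ennreal_1
        mult_nonneg_nonneg add_nonneg_nonneg zero_le_one real_sqrt_ge_zero zero_le_numeral
        divide_nonneg_nonneg less_imp_le)
    finally show ?case .
  qed
  then have "(\<integral>\<^sup>+ \<omega>. ennreal (exp ((A \<omega>)\<^sup>2 / (4 * ?D \<omega>))) \<partial>M)
      \<le> (\<integral>\<^sup>+ \<omega>. ennreal ?c * ennreal (f \<omega>) + ennreal ?d * (1 + ennreal (1 / m) * ennreal (B \<omega>)) \<partial>M)"
    by (rule nn_integral_mono_AE)
  also have "\<dots> = ennreal ?c * (\<integral>\<^sup>+ \<omega>. ennreal (f \<omega>) \<partial>M)
      + ennreal ?d * (1 + ennreal (1 / m) * ennreal m)"
    by (simp add: nn_integral_add nn_integral_cmult prob_space.emeasure_space_1 [OF prob] mean del: times_divide_eq_left)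
  also have "\<dots> \<le> ennreal ?c * 1 + ennreal ?d * (1 + ennreal (1 / m) * ennreal m)"
    using gaussian_mixture_bound [OF prob_space_imp_sigma_finite [OF prob] assms(2,3) canonical m]
    unfolding f_def by (intro add_right_mono mult_left_mono) simp_all
  also have "ennreal (1 / m) * ennreal m = 1"
    using m by (simp flip: ennreal_mult)
  also have "ennreal ?c * 1 + ennreal ?d * (1 + 1) = ennreal ?c + ennreal ?d + ennreal ?d"
    by (simp only: distrib_left mult_1_right add.assoc)
  also have "\<dots> = ennreal (sqrt 2)"
    by (simp flip: ennreal_plus)
  finally show ?thesis .
qed

section \<open>Pointwise comparisons with the exponential\<close>

text \<open>
  Truncate Euler's integral for the Gamma function to \<open>t \<ge> u\<close> and bound \<open>t powr s\<close> below by
  \<open>u powr s\<close> there; what remains is \<open>u powr s\<close> times the integral of \<open>1 / exp t\<close> over \<open>t \<ge> u\<close>.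
\<close>
lemma powr_div_exp_le_Gamma:
  fixes s u :: real
  assumes "s > 0" "u \<ge> 0"
  shows "u powr s / exp u \<le> Gamma (s + 1)"
proof -
  have "((\<lambda>t::real. u powr s / exp t) has_integral u powr s / exp u) {u..}"
    using has_integral_mult_right [OF has_integral_exp_minus_to_infinity [of 1 u]]
    by (simp add: exp_minus divide_inverse)
  then have truncated:
    "((\<lambda>t. if t \<in> {u..} then u powr s / exp t else 0) has_integral u powr s / exp u) {0..}"
    using assms(2) by (subst has_integral_restrict) auto
  have Gamma: "((\<lambda>t. t powr s / exp t) has_integral Gamma (s + 1)) {0..}"
    using Gamma_integral_real [of "s + 1"] assms(1) by simp
  have "u powr s / exp t \<le> t powr s / exp t" if "u \<le> t" for t
    using assms that by (intro divide_right_mono powr_mono2) simp_all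
  moreover have "0 \<le> t powr s / exp t" for t :: real
    by simp
  ultimately have "(if t \<in> {u..} then u powr s / exp t else 0) \<le> t powr s / exp t" for t
    by (cases "u \<le> t") (simp_all only: atLeast_iff if_True if_False)
  then show ?thesis
    by (rule has_integral_le [OF truncated Gamma])
qed

text \<open>
  The previous bound at \<open>u = (w / 2)\<^sup>2\<close> and \<open>s = p / 2\<close>, since then \<open>w powr p\<close> is
  \<open>2 powr p * u powr s\<close>. Comparing pointwise with \<open>exp (w\<^sup>2 / 4)\<close> gives the same constant as
  integrating the tail bound that Markov's inequality yields.
\<close>
lemma powr_le_Gamma_mult_exp_quarter_square:
  fixes p w :: real
  assumes "p > 0" "w \<ge> 0"
  shows "w powr p \<le> 2 powr (p - 1) * p * Gamma (p / 2) * exp (w\<^sup>2 / 4)"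
proof (cases "w = 0")
  case True
  have "Gamma (p / 2) > 0"
    using assms by (intro Gamma_real_pos) simp
  then show ?thesis
    using True assms by simp
next
  case False
  define u where "u = (w / 2)\<^sup>2"
  have "w powr p = 2 powr p * (w / 2) powr p"
    using assms by (simp add: powr_divide)
  also have "(w / 2) powr p = u powr (p / 2)"
    using False assms by (simp add: u_def powr_powr flip: powr_numeral)
  also have "\<dots> \<le> Gamma (p / 2 + 1) * exp u"
    using powr_div_exp_le_Gamma [of "p / 2" u] assms by (simp add: u_def pos_divide_le_eq)
  also have "Gamma (p / 2 + 1) = p / 2 * Gamma (p / 2)"
    using assms by (intro Gamma_plus1) (auto dest: nonpos_Ints_nonpos)
  finally show ?thesis
    by (simp add: u_def powr_diff power_divide)
qed

lemma mult_le_square_plus_quarter_square: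
  fixes x w :: real
  shows "x * w \<le> x\<^sup>2 + w\<^sup>2 / 4"
  using zero_le_power2 [of "x - w / 2"] by (simp add: power2_diff power_divide)

lemma nn_integral_le_const_mult:
  assumes [measurable]: "g \<in> borel_measurable M"
    and "\<And>\<omega>. f \<omega> \<le> k * g \<omega>" "k \<ge> 0" "(\<integral>\<^sup>+ \<omega>. ennreal (g \<omega>) \<partial>M) \<le> ennreal c" "c \<ge> 0"
  shows "(\<integral>\<^sup>+ \<omega>. ennreal (f \<omega>) \<partial>M) \<le> ennreal (k * c)"
proof -
  have "(\<integral>\<^sup>+ \<omega>. ennreal (f \<omega>) \<partial>M) \<le> (\<integral>\<^sup>+ \<omega>. ennreal k * ennreal (g \<omega>) \<partial>M)"
    using assms(2,3) by (intro nn_integral_mono) (simp add: ennreal_leI flip: ennreal_mult')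
  also have "\<dots> = ennreal k * (\<integral>\<^sup>+ \<omega>. ennreal (g \<omega>) \<partial>M)"
    by (simp add: nn_integral_cmult)
  also have "\<dots> \<le> ennreal k * ennreal c"
    by (intro mult_left_mono assms(4)) simp
  also have "\<dots> = ennreal (k * c)"
    using assms by (simp add: ennreal_mult)
  finally show ?thesis .
qed

section \<open>The self-normalized bounds\<close>

theorem theorem2p1:
  fixes M :: "'a measure" and A B :: "'a \<Rightarrow> real"
  assumes "prob_space M"
    and "A \<in> borel_measurable M"
    and "B \<in> borel_measurable M"
    and "AE \<omega> in M. 0 \<le> B \<omega>"
    and "\<And>l::real. (\<integral>\<^sup>+ \<omega>. ennreal (exp (l * A \<omega> - l\<^sup>2 / 2 * (B \<omega>)\<^sup>2)) \<partial>M) \<le> 1"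
  shows "(\<forall>y::real. y > 0 \<longrightarrow>
            (\<integral>\<^sup>+ \<omega>. ennreal (y / sqrt ((B \<omega>)\<^sup>2 + y\<^sup>2) *
                exp ((A \<omega>)\<^sup>2 / (2 * ((B \<omega>)\<^sup>2 + y\<^sup>2)))) \<partial>M) \<le> 1) \<and>
         (let EB = (\<integral>\<^sup>+ \<omega>. ennreal (B \<omega>) \<partial>M) in EB > 0 \<longrightarrow>
            (\<integral>\<^sup>+ \<omega>. ennreal (exp (quot_at_mean EB
                (\<lambda>m. (A \<omega>)\<^sup>2 / (4 * ((B \<omega>)\<^sup>2 + m\<^sup>2))))) \<partial>M) \<le> ennreal (sqrt 2) \<and>
            (\<forall>x::real. x > 0 \<longrightarrow>
              (\<integral>\<^sup>+ \<omega>. ennreal (exp (quot_at_mean EB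
                  (\<lambda>m. x * A \<omega> / sqrt ((B \<omega>)\<^sup>2 + m\<^sup>2)))) \<partial>M)
                \<le> ennreal (sqrt 2 * exp (x\<^sup>2))) \<and>
            (\<forall>p::real. p > 0 \<longrightarrow>
              (\<integral>\<^sup>+ \<omega>. ennreal (quot_at_mean EB
                  (\<lambda>m. \<bar>A \<omega>\<bar> / sqrt ((B \<omega>)\<^sup>2 + m\<^sup>2)) powr p) \<partial>M)
                \<le> ennreal (2 powr (p - 1 / 2) * p * Gamma (p / 2))))"
proof (unfold Let_def, intro conjI allI impI)
  fix y :: real
  assume "y > 0"
  show "(\<integral>\<^sup>+ \<omega>. ennreal (y / sqrt ((B \<omega>)\<^sup>2 + y\<^sup>2) *
      exp ((A \<omega>)\<^sup>2 / (2 * ((B \<omega>)\<^sup>2 + y\<^sup>2)))) \<partial>M) \<le> 1"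
    by (rule gaussian_mixture_bound
        [OF prob_space_imp_sigma_finite [OF assms(1)] assms(2,3,5) \<open>y > 0\<close>])
next
  let ?EB = "\<integral>\<^sup>+ \<omega>. ennreal (B \<omega>) \<partial>M"
  note [measurable] = assms(2,3)
  assume pos: "?EB > 0"
  (* All three quotients are functions of the normalized variable W, which is 0 for an infinite mean,
     so the two cases need to be told apart only in the bound W below. *)
  define W where "W \<omega> = quot_at_mean ?EB (\<lambda>m. A \<omega> / sqrt ((B \<omega>)\<^sup>2 + m\<^sup>2))" for \<omega>
  have [measurable]: "W \<in> borel_measurable M"
    unfolding W_def quot_at_mean_def by measurable
  have sq: "quot_at_mean ?EB (\<lambda>m. (A \<omega>)\<^sup>2 / (4 * ((B \<omega>)\<^sup>2 + m\<^sup>2))) = (W \<omega>)\<^sup>2 / 4" for \<omega>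
  proof -
    have "a\<^sup>2 / (4 * D) = (a / sqrt D)\<^sup>2 / 4" if "D \<ge> 0" for a D :: real
      using that by (simp add: power_divide)
    then show ?thesis
      by (auto simp only: W_def quot_at_mean_def sum_power2_ge_zero split: if_split) simp
  qed
  have lin: "quot_at_mean ?EB (\<lambda>m. x * A \<omega> / sqrt ((B \<omega>)\<^sup>2 + m\<^sup>2)) = x * W \<omega>" for x \<omega>
    by (simp add: W_def quot_at_mean_def)
  have abs: "quot_at_mean ?EB (\<lambda>m. \<bar>A \<omega>\<bar> / sqrt ((B \<omega>)\<^sup>2 + m\<^sup>2)) = \<bar>W \<omega>\<bar>" for \<omega>
    by (simp add: W_def quot_at_mean_def)
  have W: "(\<integral>\<^sup>+ \<omega>. ennreal (exp ((W \<omega>)\<^sup>2 / 4)) \<partial>M) \<le> ennreal (sqrt 2)"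
  proof (cases "?EB = \<infinity>")
    case True
    then show ?thesis
      by (simp add: W_def quot_at_mean_def prob_space.emeasure_space_1 [OF assms(1)])
  next
    case False
    then obtain m where m: "?EB = ennreal m" "m > 0"
      using pos by (cases ?EB) (auto simp: less_top)
    then show ?thesis
      using exp_quarter_square_bound [OF assms m(2,1)] False
      by (simp add: sq [symmetric] quot_at_mean_def)
  qed
  show "(\<integral>\<^sup>+ \<omega>. ennreal (exp (quot_at_mean ?EB
      (\<lambda>m. (A \<omega>)\<^sup>2 / (4 * ((B \<omega>)\<^sup>2 + m\<^sup>2))))) \<partial>M) \<le> ennreal (sqrt 2)"
    unfolding sq by (rule W)
  show "(\<integral>\<^sup>+ \<omega>. ennreal (exp (quot_at_mean ?EB
      (\<lambda>m. x * A \<omega> / sqrt ((B \<omega>)\<^sup>2 + m\<^sup>2)))) \<partial>M) \<le> ennreal (sqrt 2 * exp (x\<^sup>2))" for x :: real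
  proof -
    have "exp (x * W \<omega>) \<le> exp (x\<^sup>2) * exp ((W \<omega>)\<^sup>2 / 4)" for \<omega>
      by (simp add: mult_le_square_plus_quarter_square flip: exp_add)
    from nn_integral_le_const_mult [OF _ this _ W] show ?thesis
      unfolding lin by (simp add: mult.commute)
  qed
  show "(\<integral>\<^sup>+ \<omega>. ennreal (quot_at_mean ?EB
      (\<lambda>m. \<bar>A \<omega>\<bar> / sqrt ((B \<omega>)\<^sup>2 + m\<^sup>2)) powr p) \<partial>M)
      \<le> ennreal (2 powr (p - 1 / 2) * p * Gamma (p / 2))" if p: "p > 0" for p :: real
  proof -
    let ?k = "2 powr (p - 1) * p * Gamma (p / 2)"
    have "\<bar>W \<omega>\<bar> powr p \<le> ?k * exp ((W \<omega>)\<^sup>2 / 4)" for \<omega>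
      using powr_le_Gamma_mult_exp_quarter_square [OF p, of "\<bar>W \<omega>\<bar>"] by simp
    moreover have "?k \<ge> 0"
      using p Gamma_real_pos [of "p / 2"] by simp
    ultimately have "(\<integral>\<^sup>+ \<omega>. ennreal (\<bar>W \<omega>\<bar> powr p) \<partial>M) \<le> ennreal (?k * sqrt 2)"
      by (intro nn_integral_le_const_mult [OF _ _ _ W]) simp_all
    also have "?k * sqrt 2 = 2 powr (p - 1 / 2) * p * Gamma (p / 2)"
    proof -
      have "2 powr (p - 1) * sqrt 2 = 2 powr (p - 1 / 2)"
        by (simp add: powr_half_sqrt [symmetric] flip: powr_add)
      then show ?thesis
        by (simp add: mult_ac)
    qed
    finally show ?thesis
      unfolding abs .
  qed
qed

end
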